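(* Let $\langle X,d\rangle$ be a cofinally Bourbaki-complete metric space. Then $X$ is uniformly star superparacompact if and only if for every $\varepsilon>0$ there exists $\delta>0$ such that for every $x\in X$ there are finitely many points $x_1,\dots,x_k\in X$ and $m\in\mathbb N$ with $S^\infty_d(x,\delta)\subseteq\bigcup_{i=1}^k S^m_d(x_i,\varepsilon)$.
   Context: Metric spaces are assumed to contain at least two points. For $x\in X$, $\varepsilon>0$ and $m\in\mathbb N$ ($m\ge 1$), $S^m_d(x,\varepsilon)$ is the set of all $y\in X$ for which there is a sequence $x=x_0,x_1,\dots,x_m=y$ in $X$ with $d(x_{i-1},x_i)<\varepsilon$ for $i=1,\dots,m$; and $S^\infty_d(x,\varepsilon)=\bigcup_{m\in\mathbb N}S^m_d(x,\varepsilon)$. A sequence $\langle x_n\rangle$ in $X$ is cofinally Bourbaki-Cauchy if for every $\varepsilon>0$ there exist $m\in\mathbb N$, an infinite $N_\varepsilon\subseteq\mathbb N$ and $p\in X$ with $x_n\in S^m_d(p,\varepsilon)$ for every $n\in N_\varepsilon$. $X$ is cofinally Bourbaki-complete if every cofinally Bourbaki-Cauchy sequence in $X$ has a cluster point in $X$. $X$ is uniformly star superparacompact if for each open cover $\mathcal V$ of $X$ there exist $\mu>0$ and an open cover $\mathcal U$ of $X$ refining $\mathcal V$ (each member of $\mathcal U$ is contained in some member of $\mathcal V$) such that for each $x\in X$, $S^\infty_d(x,\mu)$ intersects at most finitely many members of $\mathcal U$. *)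

theory Defs
  imports "HOL-Analysis.Analysis"
begin

definition chain_ball :: "'a set \<Rightarrow> ('a \<Rightarrow> 'a \<Rightarrow> real) \<Rightarrow> nat \<Rightarrow> 'a \<Rightarrow> real \<Rightarrow> 'a set" where
  "chain_ball X d m x \<epsilon> =
     {y. \<exists>c::nat \<Rightarrow> 'a. c 0 = x \<and> c m = y \<and> (\<forall>i\<le>m. c i \<in> X) \<and>
         (\<forall>i\<in>{1..m}. d (c (i - 1)) (c i) < \<epsilon>)}"

definition chain_component :: "'a set \<Rightarrow> ('a \<Rightarrow> 'a \<Rightarrow> real) \<Rightarrow> 'a \<Rightarrow> real \<Rightarrow> 'a set" where
  "chain_component X d x \<epsilon> = (\<Union>m\<in>{1..}. chain_ball X d m x \<epsilon>)"

definition cofinally_Bourbaki_Cauchy ::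
  "'a set \<Rightarrow> ('a \<Rightarrow> 'a \<Rightarrow> real) \<Rightarrow> (nat \<Rightarrow> 'a) \<Rightarrow> bool" where
  "cofinally_Bourbaki_Cauchy X d x \<longleftrightarrow>
     range x \<subseteq> X \<and>
     (\<forall>\<epsilon>>0. \<exists>m\<ge>1. \<exists>N. infinite N \<and> (\<exists>p\<in>X. \<forall>n\<in>N. x n \<in> chain_ball X d m p \<epsilon>))"

definition seq_cluster_point :: "'a topology \<Rightarrow> (nat \<Rightarrow> 'a) \<Rightarrow> 'a \<Rightarrow> bool" where
  "seq_cluster_point T x l \<longleftrightarrow>
     l \<in> topspace T \<and> (\<forall>U. openin T U \<and> l \<in> U \<longrightarrow> infinite {n. x n \<in> U})"

definition cofinally_Bourbaki_complete :: "'a set \<Rightarrow> ('a \<Rightarrow> 'a \<Rightarrow> real) \<Rightarrow> bool" where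
  "cofinally_Bourbaki_complete X d \<longleftrightarrow>
     (\<forall>x. cofinally_Bourbaki_Cauchy X d x \<longrightarrow>
          (\<exists>l. seq_cluster_point (Metric_space.mtopology X d) x l))"

definition open_cover :: "'a topology \<Rightarrow> 'a set set \<Rightarrow> bool" where
  "open_cover T \<V> \<longleftrightarrow> (\<forall>V\<in>\<V>. openin T V) \<and> \<Union>\<V> = topspace T"

definition uniformly_star_superparacompact :: "'a set \<Rightarrow> ('a \<Rightarrow> 'a \<Rightarrow> real) \<Rightarrow> bool" where
  "uniformly_star_superparacompact X d \<longleftrightarrow>
     (\<forall>\<V>. open_cover (Metric_space.mtopology X d) \<V> \<longrightarrow>
        (\<exists>\<mu>>0. \<exists>\<U>. open_cover (Metric_space.mtopology X d) \<U> \<and>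
           (\<forall>U\<in>\<U>. \<exists>V\<in>\<V>. U \<subseteq> V) \<and>
           (\<forall>x\<in>X. finite {U \<in> \<U>. chain_component X d x \<mu> \<inter> U \<noteq> {}})))"

end

theory Submission
  imports Defs
begin

text \<open>
  Forward: refine the cover by \<open>\<epsilon>\<close>-balls. Each chain component \<open>S\<^sup>\<infinity>(x, \<mu>)\<close> is then covered by the
  finitely many members of the refinement that meet it, each of which sits in some
  ball \<open>S\<^sup>1(p, \<epsilon>)\<close>; so even \<open>m = 1\<close> suffices.

  Backward: the key fact is that cofinal Bourbaki-completeness yields, for every open cover
  \<open>\<V>\<close>, one \<open>\<epsilon>\<close> for which all sets \<open>S\<^sup>m(x, \<epsilon>)\<close>, whatever \<open>m\<close> and \<open>x\<close>, are finitely covered by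
  \<open>\<V>\<close> (lemma \<open>chain_balls_finitely_covered\<close>). The hypothesis applied to this \<open>\<epsilon>\<close> makes every
  component \<open>S\<^sup>\<infinity>(x, \<delta>)\<close> finitely covered by \<open>\<V>\<close> as well. Since the \<open>\<delta>\<close>-components are open and
  partition the space, the finite covers of the single components, cut down to these
  components, form the required refinement: a component meets only its own pieces.

  The key fact is proved by contradiction. If it fails, there are sets \<open>S\<^sup>m(x, 1/(n+1))\<close>
  without finite subcover for every \<open>n\<close>. Sample each of them infinitely often by one sequence,
  always avoiding a cover member chosen around each earlier term. The sequence is cofinally
  Bourbaki-Cauchy. If the chosen member around a term contains a ball of nearly the largest
  possible radius, terms close to a cluster point cannot avoid each other's members
  (lemma \<open>avoiding_sequence_no_cluster_point\<close>).
\<close>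

section \<open>Chains as iterated relations\<close>

definition close_rel :: "'a set \<Rightarrow> ('a \<Rightarrow> 'a \<Rightarrow> real) \<Rightarrow> real \<Rightarrow> ('a \<times> 'a) set" where
  "close_rel X d \<epsilon> = {(a, b). a \<in> X \<and> b \<in> X \<and> d a b < \<epsilon>}"

lemma chain_ball_eq_relpow:
  assumes "m \<ge> 1"
  shows "chain_ball X d m x \<epsilon> = (close_rel X d \<epsilon> ^^ m) `` {x}"
proof -
  have "((\<forall>i\<le>m. c i \<in> X) \<and> (\<forall>i\<in>{1..m}. d (c (i - 1)) (c i) < \<epsilon>)) \<longleftrightarrow>
        (\<forall>i<m. (c i, c (Suc i)) \<in> close_rel X d \<epsilon>)" (is "?L \<longleftrightarrow> ?R") for c :: "nat \<Rightarrow> 'a"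
  proof
    assume L: ?L
    show ?R
    proof (intro allI impI)
      fix i assume "i < m"
      then have "Suc i \<in> {1..m}" by simp
      then have "d (c (Suc i - 1)) (c (Suc i)) < \<epsilon>" using L by blast
      then show "(c i, c (Suc i)) \<in> close_rel X d \<epsilon>"
        using L \<open>i < m\<close> by (simp add: close_rel_def)
    qed
  next
    assume R: ?R
    have "c i \<in> X" if "i \<le> m" for i
    proof (cases "i < m")
      case True
      then show ?thesis using R by (auto simp: close_rel_def)
    next
      case False
      then have "i = Suc (m - 1)" "m - 1 < m" using that assms by auto
      then show ?thesis using R by (metis (no_types, lifting) close_rel_def case_prodD mem_Collect_eq)
    qed
    moreover have "d (c (i - 1)) (c i) < \<epsilon>" if "i \<in> {1..m}" for i
    proof -
      have "i - 1 < m" "Suc (i - 1) = i" using that by auto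
      then show ?thesis using R by (metis (no_types, lifting) close_rel_def case_prodD mem_Collect_eq)
    qed
    ultimately show ?L by blast
  qed
  then show ?thesis
    unfolding chain_ball_def by (auto simp: relpow_fun_conv)
qed

lemma chain_component_eq_trancl:
  "chain_component X d x \<epsilon> = (close_rel X d \<epsilon>)\<^sup>+ `` {x}"
proof -
  have "chain_component X d x \<epsilon> = (\<Union>m\<in>{1..}. (close_rel X d \<epsilon> ^^ m) `` {x})"
    unfolding chain_component_def by (intro SUP_cong) (simp_all add: chain_ball_eq_relpow)
  also have "\<dots> = (close_rel X d \<epsilon>)\<^sup>+ `` {x}"
    by (auto simp: trancl_power Bex_def Suc_le_eq)
  finally show ?thesis .
qed

lemma chain_ball_mono:
  assumes "\<epsilon> \<le> \<epsilon>'"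
  shows "chain_ball X d m x \<epsilon> \<subseteq> chain_ball X d m x \<epsilon>'"
  using assms unfolding chain_ball_def by fastforce

lemma chain_ball_subset: "chain_ball X d m x \<epsilon> \<subseteq> X"
  unfolding chain_ball_def by auto

lemma chain_component_subset: "chain_component X d x \<epsilon> \<subseteq> X"
  unfolding chain_component_def using chain_ball_subset by fast

context Metric_space
begin

lemma mball_subset_chain_ball: "mball x \<epsilon> \<subseteq> chain_ball M d 1 x \<epsilon>"
  unfolding chain_ball_eq_relpow[OF order_refl] by (auto simp: close_rel_def)

lemma self_in_chain_component:
  assumes "x \<in> M" "\<epsilon> > 0"
  shows "x \<in> chain_component M d x \<epsilon>"
  using assms by (auto simp: chain_component_eq_trancl close_rel_def)

lemma chain_component_eq:
  assumes "y \<in> chain_component M d x \<epsilon>"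
  shows "chain_component M d y \<epsilon> = chain_component M d x \<epsilon>"
proof -
  have "sym (close_rel M d \<epsilon>)"
    by (auto simp: sym_def close_rel_def commute)
  then have "sym ((close_rel M d \<epsilon>)\<^sup>+)" by (rule sym_trancl)
  then show ?thesis
    using assms unfolding chain_component_eq_trancl
    by (auto dest: symD intro: trancl_trans)
qed

lemma openin_chain_component:
  assumes "\<epsilon> > 0"
  shows "openin mtopology (chain_component M d x \<epsilon>)"
  unfolding openin_mtopology
proof (intro conjI allI impI)
  show "chain_component M d x \<epsilon> \<subseteq> M" by (rule chain_component_subset)
  fix y assume y: "y \<in> chain_component M d x \<epsilon>"
  have "mball y \<epsilon> \<subseteq> chain_component M d y \<epsilon>"
    unfolding chain_component_def
    by (rule order_trans[OF mball_subset_chain_ball], rule UN_upper) simp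
  then show "\<exists>r>0. mball y r \<subseteq> chain_component M d x \<epsilon>"
    using assms chain_component_eq[OF y] by blast
qed

section \<open>Finite subcovers of chain balls\<close>

text \<open>
  A greedy choice of cover members: taking the least \<open>k\<close> such that the ball of radius
  \<open>1/(k+1)\<close> fits into some member makes the choice uniform near each point, although
  the cover need not have a Lebesgue number.
\<close>
lemma locally_uniform_member_choice:
  assumes "open_cover mtopology \<V>"
  obtains W where "\<And>z. z \<in> M \<Longrightarrow> W z \<in> \<V>"
    and "\<And>l. l \<in> M \<Longrightarrow> \<exists>r>0. \<forall>z\<in>mball l r. mball l r \<subseteq> W z"
proof -
  define fits where "fits z k V \<longleftrightarrow> V \<in> \<V> \<and> mball z (inverse (real (Suc k))) \<subseteq> V" for z k V
  have nbhd: "\<exists>V\<in>\<V>. \<exists>r>0. mball l r \<subseteq> V" if "l \<in> M" for l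
    using assms that unfolding open_cover_def topspace_mtopology openin_mtopology by blast
  have fits_ex: "\<exists>k V. fits z k V" if z: "z \<in> M" for z
  proof -
    obtain V r where V: "V \<in> \<V>" "r > 0" "mball z r \<subseteq> V" using nbhd[OF z] by blast
    obtain k where "inverse (real (Suc k)) < r" using reals_Archimedean[OF V(2)] by blast
    then have "fits z k V" using V mball_subset_concentric[of _ r z] unfolding fits_def by fastforce
    then show ?thesis by blast
  qed
  define k where "k z = (LEAST k. \<exists>V. fits z k V)" for z
  define W where "W z = (SOME V. fits z (k z) V)" for z
  have W: "fits z (k z) (W z)" if "z \<in> M" for z
  proof -
    have "\<exists>V. fits z (k z) V" unfolding k_def by (rule LeastI_ex) (rule fits_ex[OF that])
    then show ?thesis unfolding W_def by (rule someI_ex)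
  qed
  show thesis
  proof (rule that)
    show "W z \<in> \<V>" if "z \<in> M" for z using W[OF that] by (simp add: fits_def)
    show "\<exists>r>0. \<forall>z\<in>mball l r. mball l r \<subseteq> W z" if l: "l \<in> M" for l
    proof -
      obtain V r where V: "V \<in> \<V>" "r > 0" "mball l r \<subseteq> V" using nbhd[OF l] by blast
      obtain K where K: "inverse (real (Suc K)) < r / 2"
        using reals_Archimedean[of "r / 2"] V(2) by auto
      define s where "s = inverse (real (Suc K)) / 2"
      have s: "s > 0" "2 * s = inverse (real (Suc K))" by (simp_all add: s_def)
      have "mball l s \<subseteq> W z" if z: "z \<in> mball l s" for z
      proof -
        have zM: "z \<in> M" and lz: "d l z < s" using z by auto
        have "mball z (inverse (real (Suc K))) \<subseteq> mball l r"
        proof (rule mball_subset)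
          show "d z l + inverse (real (Suc K)) \<le> r"
            using lz K s by (simp add: commute)
        qed (rule l)
        then have "fits z K V" using V by (auto simp: fits_def)
        then have "k z \<le> K" unfolding k_def by (intro Least_le) blast
        then have "2 * s \<le> inverse (real (Suc (k z)))"
          unfolding s(2) by (intro le_imp_inverse_le) auto
        then have "mball l s \<subseteq> mball z (inverse (real (Suc (k z))))"
          using lz zM by (intro mball_subset) auto
        then show ?thesis using W[OF zM] by (auto simp: fits_def)
      qed
      then show ?thesis using s(1) by blast
    qed
  qed
qed

text \<open>
  Two terms close to a cluster point would lie in each other's neighbourhoods, so
  the later one could not have avoided the earlier one's.
\<close>
lemma avoiding_sequence_no_cluster_point:
  assumes uniform: "\<And>l. l \<in> M \<Longrightarrow> \<exists>r>0. \<forall>z\<in>mball l r. mball l r \<subseteq> W z"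
    and avoid: "\<And>i j. i < j \<Longrightarrow> z j \<notin> W (z i)"
  shows "\<not> seq_cluster_point mtopology z l"
proof
  assume l: "seq_cluster_point mtopology z l"
  then have lM: "l \<in> M" by (simp add: seq_cluster_point_def)
  obtain r where r: "r > 0" "\<forall>z\<in>mball l r. mball l r \<subseteq> W z" using uniform[OF lM] by blast
  have inf: "infinite {n. z n \<in> mball l r}"
    using l r(1) lM unfolding seq_cluster_point_def by (simp del: in_mball)
  then obtain i where i: "z i \<in> mball l r" by (metis (mono_tags) Collect_empty_eq finite.emptyI)
  obtain j where "i < j" "z j \<in> mball l r" using inf unfolding infinite_nat_iff_unbounded by blast
  then show False using avoid i r(2) by blast
qed

text \<open>
  This is the only place where cofinal Bourbaki-completeness enters. The number \<open>m\<close> of links is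
  not bounded, so the conclusion is weaker than a finite cover of the whole component.
\<close>
lemma chain_balls_finitely_covered:
  assumes complete: "cofinally_Bourbaki_complete M d"
    and cover: "open_cover mtopology \<V>"
  obtains \<epsilon> where "\<epsilon> > 0"
    and "\<And>x m. x \<in> M \<Longrightarrow> m \<ge> 1 \<Longrightarrow> \<exists>F\<subseteq>\<V>. finite F \<and> chain_ball M d m x \<epsilon> \<subseteq> \<Union>F"
proof (rule ccontr)
  assume "\<not> thesis"
  with that have "\<exists>x m. x \<in> M \<and> m \<ge> 1 \<and> \<not> (\<exists>F\<subseteq>\<V>. finite F \<and> chain_ball M d m x \<epsilon> \<subseteq> \<Union>F)"
    if "\<epsilon> > 0" for \<epsilon>
    using \<open>\<epsilon> > 0\<close> by blast
  then have "\<forall>n. \<exists>x m. x \<in> M \<and> m \<ge> 1 \<and>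
      \<not> (\<exists>F\<subseteq>\<V>. finite F \<and> chain_ball M d m x (inverse (real (Suc n))) \<subseteq> \<Union>F)"
    by simp
  then obtain p m where pm: "\<And>n. p n \<in> M" "\<And>n. m n \<ge> (1::nat)"
    "\<And>n. \<not> (\<exists>F\<subseteq>\<V>. finite F \<and> chain_ball M d (m n) (p n) (inverse (real (Suc n))) \<subseteq> \<Union>F)"
    by metis
  define A where "A n = chain_ball M d (m n) (p n) (inverse (real (Suc n)))" for n
  have AM: "A n \<subseteq> M" for n unfolding A_def by (rule chain_ball_subset)
  obtain W where W: "\<And>z. z \<in> M \<Longrightarrow> W z \<in> \<V>"
    "\<And>l. l \<in> M \<Longrightarrow> \<exists>r>0. \<forall>z\<in>mball l r. mball l r \<subseteq> W z"
    using locally_uniform_member_choice[OF cover] by blast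
  \<comment> \<open>Decoding the index as a pair visits every \<open>A n\<close> infinitely often.\<close>
  have "\<exists>z. \<forall>j. z j \<in> A (fst (prod_decode j)) - (\<Union>i<j. W (z i))"
  proof (rule dependent_wellorder_choice)
    fix z :: "nat \<Rightarrow> 'a" and j
    assume "\<And>i. i < j \<Longrightarrow> z i \<in> A (fst (prod_decode i)) - (\<Union>k<i. W (z k))"
    then have "W ` z ` {..<j} \<subseteq> \<V>" using W(1) AM by blast
    moreover have "finite (W ` z ` {..<j})" by simp
    ultimately have "\<not> A (fst (prod_decode j)) \<subseteq> \<Union>(W ` z ` {..<j})"
      using pm(3)[of "fst (prod_decode j)"] unfolding A_def by metis
    then show "\<exists>r. r \<in> A (fst (prod_decode j)) - (\<Union>i<j. W (z i))" by auto
  qed auto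
  then obtain z where z: "\<And>j. z j \<in> A (fst (prod_decode j))" "\<And>i j. i < j \<Longrightarrow> z j \<notin> W (z i)"
    by blast
  have "cofinally_Bourbaki_Cauchy M d z"
    unfolding cofinally_Bourbaki_Cauchy_def
  proof (intro conjI allI impI)
    show "range z \<subseteq> M" using z(1) AM by blast
    fix \<epsilon> :: real assume "\<epsilon> > 0"
    then obtain n where n: "inverse (real (Suc n)) < \<epsilon>" using reals_Archimedean by blast
    let ?N = "range (\<lambda>k. prod_encode (n, k))"
    have "inj (\<lambda>k. prod_encode (n, k))" by (auto simp: inj_on_def)
    then have "infinite ?N" by (rule range_inj_infinite)
    moreover have "z j \<in> chain_ball M d (m n) (p n) \<epsilon>" if "j \<in> ?N" for j
    proof -
      have "z j \<in> A n" using that z(1)[of j] by auto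
      then show ?thesis unfolding A_def by (rule subsetD[OF chain_ball_mono[OF less_imp_le[OF n]]])
    qed
    ultimately show "\<exists>m\<ge>1. \<exists>N. infinite N \<and> (\<exists>p\<in>M. \<forall>n\<in>N. z n \<in> chain_ball M d m p \<epsilon>)"
      using pm(1,2) by blast
  qed
  then obtain l where "seq_cluster_point mtopology z l"
    using complete unfolding cofinally_Bourbaki_complete_def by blast
  then show False using avoiding_sequence_no_cluster_point[of W z] W(2) z(2) by blast
qed

section \<open>The two implications\<close>

text \<open>
  The \<open>\<mu>\<close>-components are open and pairwise disjoint, so finite covers of the single components,
  restricted to them, do not interfere.
\<close>
lemma refinement_by_chain_components:
  assumes cover: "open_cover mtopology \<V>" and "\<mu> > 0"
    and fin: "\<And>x. x \<in> M \<Longrightarrow> \<exists>F\<subseteq>\<V>. finite F \<and> chain_component M d x \<mu> \<subseteq> \<Union>F"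
  shows "\<exists>\<U>. open_cover mtopology \<U> \<and> (\<forall>U\<in>\<U>. \<exists>V\<in>\<V>. U \<subseteq> V) \<and>
           (\<forall>x\<in>M. finite {U \<in> \<U>. chain_component M d x \<mu> \<inter> U \<noteq> {}})"
proof -
  let ?C = "\<lambda>x. chain_component M d x \<mu>"
  \<comment> \<open>The finite cover is chosen per component, not per point: two choices for the same
      component would spoil finiteness.\<close>
  have "\<forall>C\<in>?C ` M. \<exists>F\<subseteq>\<V>. finite F \<and> C \<subseteq> \<Union>F" using fin by blast
  then obtain F where F: "\<And>C. C \<in> ?C ` M \<Longrightarrow> F C \<subseteq> \<V> \<and> finite (F C) \<and> C \<subseteq> \<Union>(F C)" by metis
  define \<U> where "\<U> = (\<Union>C\<in>?C ` M. (\<inter>) C ` F C)"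
  have \<U>_iff: "U \<in> \<U> \<longleftrightarrow> (\<exists>x\<in>M. \<exists>V\<in>F (?C x). U = ?C x \<inter> V)" for U
    unfolding \<U>_def by auto
  have "openin mtopology U" if U: "U \<in> \<U>" for U
  proof -
    obtain x V where "x \<in> M" "V \<in> F (?C x)" "U = ?C x \<inter> V" using U unfolding \<U>_iff by blast
    moreover have "V \<in> \<V>" using F \<open>x \<in> M\<close> \<open>V \<in> F (?C x)\<close> by blast
    ultimately show ?thesis
      using cover openin_chain_component[OF \<open>\<mu> > 0\<close>] unfolding open_cover_def by blast
  qed
  moreover have "M \<subseteq> \<Union>\<U>"
  proof
    fix x assume x: "x \<in> M"
    then have "x \<in> ?C x" using self_in_chain_component \<open>\<mu> > 0\<close> by blast
    moreover from this obtain V where "V \<in> F (?C x)" "x \<in> V" using F[of "?C x"] x by blast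
    ultimately show "x \<in> \<Union>\<U>" using x \<U>_iff by blast
  qed
  ultimately have "open_cover mtopology \<U>"
    unfolding open_cover_def topspace_mtopology by (meson Sup_least openin_mtopology subset_antisym)
  moreover have "\<exists>V\<in>\<V>. U \<subseteq> V" if "U \<in> \<U>" for U
    using that F unfolding \<U>_iff by blast
  moreover have "finite {U \<in> \<U>. ?C x \<inter> U \<noteq> {}}" if x: "x \<in> M" for x
  proof (rule finite_subset)
    show "{U \<in> \<U>. ?C x \<inter> U \<noteq> {}} \<subseteq> (\<inter>) (?C x) ` F (?C x)"
    proof clarify
      fix U assume "U \<in> \<U>" and ne: "?C x \<inter> U \<noteq> {}"
      then obtain y V where U: "V \<in> F (?C y)" "U = ?C y \<inter> V" unfolding \<U>_iff by metis
      then obtain w where "w \<in> ?C x" "w \<in> ?C y" using ne by blast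
      then have "?C y = ?C x" using chain_component_eq by metis
      then show "U \<in> (\<inter>) (?C x) ` F (?C x)" using U by simp
    qed
    show "finite ((\<inter>) (?C x) ` F (?C x))" using F x by blast
  qed
  ultimately show ?thesis by blast
qed

lemma uniformly_star_superparacompact_imp_finite_balls:
  assumes ussp: "uniformly_star_superparacompact M d" and "\<epsilon> > 0"
  shows "\<exists>\<mu>>0. \<forall>x\<in>M. \<exists>F. finite F \<and> F \<subseteq> M \<and> chain_component M d x \<mu> \<subseteq> (\<Union>y\<in>F. mball y \<epsilon>)"
proof -
  have "open_cover mtopology ((\<lambda>p. mball p \<epsilon>) ` M)"
    using \<open>\<epsilon> > 0\<close> by (auto simp: open_cover_def)
  with ussp have "\<exists>\<mu>>0. \<exists>\<U>. open_cover mtopology \<U> \<and>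
      (\<forall>U\<in>\<U>. \<exists>V\<in>(\<lambda>p. mball p \<epsilon>) ` M. U \<subseteq> V) \<and>
      (\<forall>x\<in>M. finite {U \<in> \<U>. chain_component M d x \<mu> \<inter> U \<noteq> {}})"
    unfolding uniformly_star_superparacompact_def by (elim allE impE)
  then obtain \<mu> \<U> where \<mu>: "\<mu> > 0" and cov: "open_cover mtopology \<U>"
    and ref: "\<forall>U\<in>\<U>. \<exists>V\<in>(\<lambda>p. mball p \<epsilon>) ` M. U \<subseteq> V"
    and fin: "\<forall>x\<in>M. finite {U \<in> \<U>. chain_component M d x \<mu> \<inter> U \<noteq> {}}"
    by (elim exE conjE) (rule that)
  obtain p where p: "\<And>U. U \<in> \<U> \<Longrightarrow> p U \<in> M \<and> U \<subseteq> mball (p U) \<epsilon>"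
    using ref unfolding bex_simps by metis
  show ?thesis
  proof (intro exI[of _ \<mu>] conjI \<mu> ballI)
    fix x assume x: "x \<in> M"
    let ?H = "{U \<in> \<U>. chain_component M d x \<mu> \<inter> U \<noteq> {}}"
    have "chain_component M d x \<mu> \<subseteq> \<Union>?H"
      using cov chain_component_subset[of M d x \<mu>] unfolding open_cover_def topspace_mtopology by blast
    also have "\<dots> \<subseteq> (\<Union>y\<in>p ` ?H. mball y \<epsilon>)" using p by blast
    finally show "\<exists>F. finite F \<and> F \<subseteq> M \<and> chain_component M d x \<mu> \<subseteq> (\<Union>y\<in>F. mball y \<epsilon>)"
      using fin x p by (intro exI[of _ "p ` ?H"]) blast
  qed
qed

end

theorem mainTheorem6:
  fixes X :: "'a set" and d :: "'a \<Rightarrow> 'a \<Rightarrow> real"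
  assumes "Metric_space X d"
    and "\<exists>a\<in>X. \<exists>b\<in>X. a \<noteq> b"
    and "cofinally_Bourbaki_complete X d"
  shows "uniformly_star_superparacompact X d \<longleftrightarrow>
    (\<forall>\<epsilon>>0. \<exists>\<delta>>0. \<forall>x\<in>X. \<exists>F m. finite F \<and> F \<subseteq> X \<and> m \<ge> 1 \<and>
       chain_component X d x \<delta> \<subseteq> (\<Union>y\<in>F. chain_ball X d m y \<epsilon>))"
proof -
  interpret Metric_space X d by (rule assms(1))
  show ?thesis
  proof (intro iffI allI impI)
    fix \<epsilon> :: real
    assume "uniformly_star_superparacompact X d" "\<epsilon> > 0"
    then obtain \<mu> where "\<mu> > 0" and \<mu>: "\<And>x. x \<in> X \<Longrightarrow>
        \<exists>F. finite F \<and> F \<subseteq> X \<and> chain_component X d x \<mu> \<subseteq> (\<Union>y\<in>F. mball y \<epsilon>)"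
      using uniformly_star_superparacompact_imp_finite_balls[of \<epsilon>] by auto
    show "\<exists>\<delta>>0. \<forall>x\<in>X. \<exists>F m. finite F \<and> F \<subseteq> X \<and> m \<ge> 1 \<and>
       chain_component X d x \<delta> \<subseteq> (\<Union>y\<in>F. chain_ball X d m y \<epsilon>)"
    proof (intro exI[of _ \<mu>] conjI \<open>\<mu> > 0\<close> ballI)
      fix x assume "x \<in> X"
      obtain F where F: "finite F" "F \<subseteq> X" "chain_component X d x \<mu> \<subseteq> (\<Union>y\<in>F. mball y \<epsilon>)"
        using \<mu>[OF \<open>x \<in> X\<close>] by (elim exE conjE) (rule that)
      have "(\<Union>y\<in>F. mball y \<epsilon>) \<subseteq> (\<Union>y\<in>F. chain_ball X d 1 y \<epsilon>)"
        using mball_subset_chain_ball by (intro UN_mono) auto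
      then show "\<exists>F m. finite F \<and> F \<subseteq> X \<and> m \<ge> 1 \<and>
          chain_component X d x \<mu> \<subseteq> (\<Union>y\<in>F. chain_ball X d m y \<epsilon>)"
        using F by (intro exI[of _ F] exI[of _ 1]) auto
    qed
  next
    assume bounded: "\<forall>\<epsilon>>0. \<exists>\<delta>>0. \<forall>x\<in>X. \<exists>F m. finite F \<and> F \<subseteq> X \<and> m \<ge> 1 \<and>
       chain_component X d x \<delta> \<subseteq> (\<Union>y\<in>F. chain_ball X d m y \<epsilon>)"
    show "uniformly_star_superparacompact X d"
      unfolding uniformly_star_superparacompact_def
    proof (intro allI impI)
      fix \<V> assume cover: "open_cover mtopology \<V>"
      obtain \<epsilon> where "\<epsilon> > 0" and \<epsilon>: "\<And>x m. x \<in> X \<Longrightarrow> m \<ge> 1 \<Longrightarrow>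
          \<exists>G\<subseteq>\<V>. finite G \<and> chain_ball X d m x \<epsilon> \<subseteq> \<Union>G"
        using chain_balls_finitely_covered[OF assms(3) cover] by blast
      obtain \<delta> where "\<delta> > 0" and \<delta>: "\<forall>x\<in>X. \<exists>F m. finite F \<and> F \<subseteq> X \<and> m \<ge> 1 \<and>
          chain_component X d x \<delta> \<subseteq> (\<Union>y\<in>F. chain_ball X d m y \<epsilon>)"
        using bounded[rule_format, OF \<open>\<epsilon> > 0\<close>] by (elim exE conjE) (rule that)
      have "\<exists>G\<subseteq>\<V>. finite G \<and> chain_component X d x \<delta> \<subseteq> \<Union>G" if "x \<in> X" for x
      proof -
        obtain F m where F: "finite F" "F \<subseteq> X" "m \<ge> 1"
          "chain_component X d x \<delta> \<subseteq> (\<Union>y\<in>F. chain_ball X d m y \<epsilon>)"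
          using bspec[OF \<delta> \<open>x \<in> X\<close>] by (elim exE conjE) (rule that)
        have "\<forall>y\<in>F. \<exists>G\<subseteq>\<V>. finite G \<and> chain_ball X d m y \<epsilon> \<subseteq> \<Union>G"
          using \<epsilon> F(2,3) by blast
        then obtain G where G: "\<forall>y\<in>F. G y \<subseteq> \<V> \<and> finite (G y) \<and> chain_ball X d m y \<epsilon> \<subseteq> \<Union>(G y)"
          by metis
        have "chain_component X d x \<delta> \<subseteq> \<Union>(\<Union>y\<in>F. G y)" using F(4) G by blast
        then show ?thesis using F(1) G by (intro exI[of _ "\<Union>y\<in>F. G y"]) blast
      qed
      then show "\<exists>\<mu>>0. \<exists>\<U>. open_cover mtopology \<U> \<and> (\<forall>U\<in>\<U>. \<exists>V\<in>\<V>. U \<subseteq> V) \<and>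
          (\<forall>x\<in>X. finite {U \<in> \<U>. chain_component X d x \<mu> \<inter> U \<noteq> {}})"
        by (intro exI[of _ \<delta>] conjI \<open>\<delta> > 0\<close> refinement_by_chain_components[OF cover \<open>\<delta> > 0\<close>])
    qed
  qed
qed

end
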